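(* $$\int_{-\pi/2}^{\pi/2}\frac{\cos\theta\,\sin\bigl((\pi/2)\cos\theta\bigr)\,e^{-(\pi/2)\sin\theta}}{\cosh(\pi\sin\theta)-\cos(\pi\cos\theta)}\,d\theta=\frac12+\frac{\pi^2}{48}.$$ *)

theory Defs
  imports "HOL-Analysis.Analysis"
begin

end

theory Submission
  imports Defs "HOL-Complex_Analysis.Complex_Analysis"
begin

text \<open>
  Put \<open>w = (\<pi>/2) e\<^sup>i\<^sup>\<theta> = x + i y\<close>. The denominator is
  \<open>cosh 2y - cos 2x = 2 \<bar>sin w\<bar>\<^sup>2\<close>, and since the interval is symmetric, only the
  part of the integrand that is even in \<open>\<theta>\<close> matters; there \<open>e\<^sup>-\<^sup>y\<close> becomes \<open>cosh y\<close>.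
  Now \<open>sin x cosh y = Re (sin w)\<close> and \<open>Re (sin w) / \<bar>sin w\<bar>\<^sup>2 = Re (1 / sin w)\<close>, so the
  even part is half of \<open>Re (cos \<theta> / sin w)\<close> (\<open>Re_cos_over_sin\<close>).

  This function of \<open>\<theta>\<close> has period \<open>\<pi>\<close>, so its integral over the half circle is half of that
  over the whole circle (\<open>has_integral_periodic_shift\<close>). On the circle
  \<open>2 cos \<theta> = z + 1/z\<close> with \<open>z = e\<^sup>i\<^sup>\<theta>\<close>, so Cauchy's formula
  (\<open>has_integral_cos_over_sin\<close>) expresses the latter through the two Laurent coefficients in
  \<open>1 / sin (\<pi>z/2) = (2/\<pi>) z\<^sup>-\<^sup>1 + (\<pi>/12) z + \<dots>\<close>; the next poles \<open>z = \<plusminus>2\<close> lie outside the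
  unit circle. The two coefficients give the two summands of the result.
\<close>

text \<open>
  Removing the simple pole of \<open>1 / sin (\<pi>z/2)\<close> at the origin makes Cauchy's formula for higher
  derivatives applicable, so that no residue at a triple pole has to be computed.
\<close>

definition sin_quot :: "complex \<Rightarrow> complex"
  where "sin_quot z = (if z = 0 then 2 / of_real pi else z / sin (of_real pi / 2 * z))"

lemma sin_half_pi_eq_0_iff:
  fixes z :: complex
  assumes "norm z < 2"
  shows "sin (of_real pi / 2 * z) = 0 \<longleftrightarrow> z = 0"
proof
  assume "sin (of_real pi / 2 * z) = 0"
  then obtain n :: int where "of_real pi / 2 * z = of_real (n * pi)"
    by (auto simp: sin_eq_0)
  hence z: "z = of_int (2 * n)"
    by (simp add: field_simps)
  hence "\<bar>real_of_int (2 * n)\<bar> < 2"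
    using assms by (metis norm_of_int)
  hence "n = 0" by linarith
  thus "z = 0" using z by simp
qed simp

lemma sin_quot_holomorphic: "sin_quot holomorphic_on ball 0 2"
proof -
  have "(\<lambda>z. if z = 0 then 2 / of_real pi else z / sin (of_real pi / 2 * z)) holomorphic_on ball (0::complex) 2"
  proof (rule removable_singularity)
    show "(\<lambda>z. z / sin (of_real pi / 2 * z)) holomorphic_on ball (0::complex) 2 - {0}"
      using sin_half_pi_eq_0_iff by (intro holomorphic_intros) auto
    have "((\<lambda>z::complex. sin (of_real pi / 2 * z)) has_field_derivative of_real pi / 2) (at 0)"
      by (auto intro!: derivative_eq_intros)
    hence "((\<lambda>z::complex. sin (of_real pi / 2 * z) / z) \<longlongrightarrow> of_real pi / 2) (at 0)"
      by (simp add: has_field_derivative_iff)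
    from tendsto_inverse[OF this]
    show "(\<lambda>z::complex. z / sin (of_real pi / 2 * z)) \<midarrow>0\<rightarrow> 2 / of_real pi"
      by simp
  qed auto
  thus ?thesis
    by (simp add: sin_quot_def[abs_def])
qed

text \<open>
  The coefficients come from the power series identity
  \<open>sin (\<pi>z/2) * sin_quot z = z\<close>: its coefficient at \<open>z\<^sup>3\<close> determines the quadratic
  coefficient of \<^const>\<open>sin_quot\<close> from the constant one.
\<close>

lemma sin_quot_Taylor:
  "sin_quot 0 = 2 / of_real pi" "(deriv ^^ 2) sin_quot 0 / fact 2 = of_real pi / 12"
proof -
  show z: "sin_quot 0 = 2 / of_real pi" by (simp add: sin_quot_def)
  define H where "H = fps_expansion sin_quot 0"
  have H: "sin_quot has_fps_expansion H"
    unfolding H_def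
    by (rule has_fps_expansion_fps_expansion[of "ball 0 2"]) (auto intro: sin_quot_holomorphic)
  have "(\<lambda>z. sin (of_real pi / 2 * z) * sin_quot z) has_fps_expansion fps_sin (of_real pi / 2) * H"
    by (intro fps_expansion_intros H)
  moreover have "\<forall>\<^sub>F z in nhds 0. sin (of_real pi / 2 * z) * sin_quot z = z"
  proof -
    have "\<forall>\<^sub>F z::complex in nhds 0. z \<in> ball 0 2"
      by (intro eventually_nhds_in_open) auto
    thus ?thesis
    proof eventually_elim
      case (elim z)
      thus ?case
        using sin_half_pi_eq_0_iff[of z] by (auto simp: sin_quot_def)
    qed
  qed
  ultimately have "(\<lambda>z. z) has_fps_expansion fps_sin (of_real pi / 2) * H"
    by (simp cong: has_fps_expansion_cong)
  hence eq: "fps_sin (of_real pi / 2) * H = fps_X"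
    using has_fps_expansion_fps_X fps_expansion_unique_complex by blast
  have H0: "fps_nth H 0 = 2 / of_real pi"
    using fps_nth_fps_expansion[OF H, of 0] z by simp
  have "fps_nth (fps_sin (of_real pi / 2) * H) 3 = 0"
    by (simp add: eq)
  moreover have "fps_nth (fps_sin c * H) 3 = c * fps_nth H 2 - c ^ 3 / 6 * fps_nth H 0" for c
  proof -
    have "{0..3} = {0, 1, 2, 3::nat}" by auto
    moreover have "(fact 3 :: complex) = 6" by (simp add: fact_numeral)
    ultimately show ?thesis
      by (simp add: fps_mult_nth fps_sin_def)
  qed
  ultimately have "of_real pi / 2 * fps_nth H 2 = (of_real pi / 2) ^ 3 / 6 * (2 / of_real pi)"
    by (simp add: H0)
  hence "fps_nth H 2 = of_real pi / 12"
    by (simp add: field_simps power3_eq_cube)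
  thus "(deriv ^^ 2) sin_quot 0 / fact 2 = of_real pi / 12"
    using fps_nth_fps_expansion[OF H, of 2] by simp
qed

text \<open>
  In terms of \<open>z = cis t\<close> the integrand is \<open>(z + 1/z) / (2 sin (\<pi>z/2))\<close> and
  \<open>dt = dz / (i z)\<close>, so the integral is \<open>1 / (2 i)\<close> times the contour integral of
  \<open>sin_quot z / z + sin_quot z / z\<^sup>3\<close>.
\<close>

lemma has_integral_cos_over_sin:
  "((\<lambda>t. complex_of_real (cos t) / sin (of_real pi / 2 * cis t))
    has_integral complex_of_real (2 + pi\<^sup>2 / 12)) {0..2 * pi}"
proof -
  have holo: "sin_quot holomorphic_on ball 0 1" and cont: "continuous_on (cball 0 1) sin_quot"
    using sin_quot_holomorphic
    by (auto intro!: holomorphic_on_imp_continuous_on elim!: holomorphic_on_subset)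
  have C: "((\<lambda>u. sin_quot u / (u - 0) ^ Suc k) has_contour_integral
          2 * of_real pi * \<i> / fact k * (deriv ^^ k) sin_quot 0) (circlepath 0 1)" for k
    using Cauchy_has_contour_integral_higher_derivative_circlepath[OF cont holo, of 0 k] by simp
  have D2: "(deriv ^^ 2) sin_quot 0 = of_real pi / 6"
    using sin_quot_Taylor(2) by (simp add: field_simps)
  have "((\<lambda>u. sin_quot u / u + sin_quot u / u ^ 3) has_contour_integral
          2 * of_real pi * \<i> * (2 / of_real pi + of_real pi / 12)) (circlepath 0 1)"
    using has_contour_integral_add[OF C[of 0] C[of 2]] sin_quot_Taylor(1) D2
    by (simp add: numeral_3_eq_3 algebra_simps)
  hence "((\<lambda>t. (sin_quot (cis t) / cis t + sin_quot (cis t) / cis t ^ 3) * \<i> * cis t)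
          has_integral 2 * of_real pi * \<i> * (2 / of_real pi + of_real pi / 12)) {0..2 * pi}"
    by (simp add: circlepath_def has_contour_integral_part_circlepath_iff)
  hence "((\<lambda>t. 1 / (2 * \<i>) * ((sin_quot (cis t) / cis t + sin_quot (cis t) / cis t ^ 3) * \<i> * cis t))
          has_integral 1 / (2 * \<i>) * (2 * of_real pi * \<i> * (2 / of_real pi + of_real pi / 12))) {0..2 * pi}"
    by (rule has_integral_mult_right)
  moreover have "1 / (2 * \<i>) * (2 * of_real pi * \<i> * (2 / of_real pi + of_real pi / 12))
      = complex_of_real (2 + pi\<^sup>2 / 12)"
    by (simp add: field_simps power2_eq_square)
  moreover have "1 / (2 * \<i>) * ((sin_quot (cis t) / cis t + sin_quot (cis t) / cis t ^ 3) * \<i> * cis t)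
      = complex_of_real (cos t) / sin (of_real pi / 2 * cis t)" for t
  proof -
    have alg: "1 / (2 * \<i>) * ((z / s / z + z / s / z ^ 3) * \<i> * z) = (z + inverse z) / (2 * s)"
      if "z \<noteq> 0" "s \<noteq> 0" for z s :: complex
      using that by (simp add: field_simps power3_eq_cube)
    have c: "cis t + inverse (cis t) = 2 * complex_of_real (cos t)"
      by (simp add: complex_eq_iff)
    have "1 / (2 * \<i>) * ((sin_quot (cis t) / cis t + sin_quot (cis t) / cis t ^ 3) * \<i> * cis t)
        = (cis t + inverse (cis t)) / (2 * sin (of_real pi / 2 * cis t))"
      using alg[of "cis t" "sin (of_real pi / 2 * cis t)"] sin_half_pi_eq_0_iff[of "cis t"]
      by (simp add: sin_quot_def)
    thus ?thesis unfolding c by simp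
  qed
  ultimately show ?thesis by (simp only:)
qed

text \<open>
  The link between the real integrand and the complex one is
  \<open>cosh 2y - cos 2x = 2 \<bar>sin (x + i y)\<bar>\<^sup>2\<close>. It also shows that the denominator has no zeros,
  because the sine vanishes nowhere on the circle of radius \<open>\<pi>/2\<close>.
\<close>

lemma Re_cos_over_sin:
  fixes t :: real
  shows "Re (complex_of_real (cos t) / sin (of_real pi / 2 * cis t)) =
    2 * cos t * sin (pi / 2 * cos t) * cosh (pi / 2 * sin t) / (cosh (pi * sin t) - cos (pi * cos t))"
    and "cosh (pi * sin t) - cos (pi * cos t) \<noteq> 0"
proof -
  define w where "w = of_real pi / 2 * cis t"
  define x y where "x = pi / 2 * cos t" and "y = pi / 2 * sin t"
  have xy: "Re w = x" "Im w = y" by (simp_all add: w_def x_def y_def)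
  have "sin w \<noteq> 0"
    using sin_half_pi_eq_0_iff[of "cis t"] by (simp add: w_def)
  have R: "Re (sin w) = sin x * cosh y" and I: "Im (sin w) = cos x * sinh y"
    by (simp_all add: Re_sin Im_sin xy cosh_def sinh_def)
  have "(norm (sin w))\<^sup>2 = (sin x)\<^sup>2 * (cosh y)\<^sup>2 + (cos x)\<^sup>2 * (sinh y)\<^sup>2"
    by (simp add: cmod_power2 R I power_mult_distrib)
  also have "\<dots> = (cosh (2 * y) - cos (2 * x)) / 2"
    unfolding cosh_double cos_double by (simp add: sinh_square_eq cos_squared_eq algebra_simps)
  finally have n: "cosh (pi * sin t) - cos (pi * cos t) = 2 * (norm (sin w))\<^sup>2"
    by (simp add: x_def y_def)
  show "cosh (pi * sin t) - cos (pi * cos t) \<noteq> 0"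
    unfolding n using \<open>sin w \<noteq> 0\<close> by simp
  have "Re (complex_of_real (cos t) / sin w) = cos t * Re (sin w) / (norm (sin w))\<^sup>2"
    by (simp add: Re_divide cmod_power2)
  thus "Re (complex_of_real (cos t) / sin (of_real pi / 2 * cis t)) =
    2 * cos t * sin (pi / 2 * cos t) * cosh (pi / 2 * sin t) / (cosh (pi * sin t) - cos (pi * cos t))"
    unfolding n R by (simp add: w_def x_def y_def)
qed

text \<open>
  Translation by the period moves \<open>[p, 2p]\<close> onto \<open>[0, p]\<close>, which halves the integral, and
  \<open>[a, p]\<close> onto \<open>[a - p, 0]\<close>, which turns \<open>[0, p]\<close> into the required interval.
\<close>

lemma has_integral_periodic_shift:
  fixes E :: "real \<Rightarrow> real"
  assumes cont: "continuous_on UNIV E" and per: "\<And>t. E (t + p) = E t" and "0 \<le> p"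
    and a: "0 \<le> a" "a \<le> p"
    and int: "(E has_integral I) {0..2 * p}"
  shows "(E has_integral I / 2) {a - p..a}"
proof -
  have E: "E integrable_on {u..v}" for u v
    using cont by (intro integrable_continuous_real continuous_on_subset[OF cont]) auto
  have sh: "integral {u - p..v - p} E = integral {u..v} E" for u v
    using has_integral_shift_real_ivl[OF integrable_integral[OF E[of u v]], of p]
    by (auto simp: per intro!: integral_unique)
  have "I = integral {0..p} E + integral {p..2 * p} E"
    using int \<open>0 \<le> p\<close>
    by (subst Henstock_Kurzweil_Integration.integral_combine) (auto simp: E integral_unique)
  hence "integral {0..p} E = I / 2"
    using sh[of p "2 * p"] by simp
  moreover have "integral {0..a} E + integral {a..p} E = integral {0..p} E"
    by (rule Henstock_Kurzweil_Integration.integral_combine) (use a E in auto)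
  moreover have "integral {a - p..0} E + integral {0..a} E = integral {a - p..a} E"
    by (rule Henstock_Kurzweil_Integration.integral_combine) (use a E in auto)
  ultimately have "integral {a - p..a} E = I / 2"
    using sh[of a p] by simp
  thus ?thesis
    using integrable_integral[OF E] by metis
qed

theorem mainTheorem12:
  shows "((\<lambda>\<theta>::real.
            (cos \<theta> * sin ((pi / 2) * cos \<theta>) * exp (- (pi / 2) * sin \<theta>)) /
            (cosh (pi * sin \<theta>) - cos (pi * cos \<theta>)))
          has_integral (1 / 2 + pi\<^sup>2 / 48)) {- (pi / 2)..pi / 2}"
    (is "(?f has_integral _) _")
proof -
  define E where "E = (\<lambda>t. Re (complex_of_real (cos t) / sin (of_real pi / 2 * cis t)))"
  \<comment> \<open>Adding the reflected integrand cancels the odd part.\<close>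
  have even_part: "?f t + ?f (-t) = E t" for t
  proof -
    have "cosh (pi / 2 * sin t) = (exp (- (pi / 2) * sin t) + exp (- (pi / 2) * sin (- t))) / 2"
      by (simp add: cosh_field_def)
    thus ?thesis
      unfolding E_def Re_cos_over_sin(1) by (simp add: add_divide_distrib algebra_simps)
  qed
  have "(E has_integral 2 + pi\<^sup>2 / 12) {0..2 * pi}"
    using has_integral_linear[OF has_integral_cos_over_sin bounded_linear_Re]
    by (simp add: o_def E_def)
  moreover have "continuous_on UNIV E"
    unfolding E_def Re_cos_over_sin(1)
    using Re_cos_over_sin(2) by (intro continuous_intros) auto
  moreover have "E (t + pi) = E t" for t
    unfolding E_def Re_cos_over_sin(1) by simp
  ultimately have "(E has_integral (2 + pi\<^sup>2 / 12) / 2) {pi / 2 - pi..pi / 2}"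
    by (intro has_integral_periodic_shift) auto
  hence intE: "(E has_integral (1 + pi\<^sup>2 / 24)) {- (pi / 2)..pi / 2}"
    by (simp add: field_simps)
  have "?f integrable_on {- (pi / 2)..pi / 2}"
    using Re_cos_over_sin(2) by (intro integrable_continuous_real continuous_intros) auto
  then obtain J where J: "(?f has_integral J) {- (pi / 2)..pi / 2}"
    by blast
  hence "((\<lambda>t. ?f (-t)) has_integral J) {- (pi / 2)..pi / 2}"
    using has_integral_reflect_real[of ?f J "pi / 2" "- (pi / 2)", unfolded minus_minus] by blast
  from has_integral_add[OF J this] have "(E has_integral J + J) {- (pi / 2)..pi / 2}"
    by (simp only: even_part)
  hence "J + J = 1 + pi\<^sup>2 / 24"
    using intE has_integral_unique by blast
  hence "J = 1 / 2 + pi\<^sup>2 / 48" by simp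
  with J show ?thesis by simp
qed

end
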